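(* Let $R$ be a finite non-commutative ring with unity and let $S, K$ be two subrings of $R$ such that $S \subseteq K$. Let $A = \{s_1, s_2, \dots, s_n\}$ be a generating set for $S$. If $A \cap C_K(S) = \{s_{m+1}, \dots, s_n\}$, then $B = \{s_1, s_2, \dots, s_m\} \cup \{s_1 + s_{m+1}, s_1 + s_{m+2}, \dots, s_1 + s_n\}$ is a dominating set for $\Gamma_{S,K}$.
   Context: For subrings $S, K$ of a finite ring $R$, put $C_K(S) = \{k \in K : ks = sk \ \forall s \in S\}$ and $C_S(K) = \{s \in S : ks = sk \ \forall k \in K\}$. The generalized non-commuting graph $\Gamma_{S,K}$ is the simple graph with vertex set $(S \cup K) \setminus (C_K(S) \cup C_S(K))$ (which is $K \setminus C_K(S)$ when $S \subseteq K$) in which two distinct vertices $a, b$ are adjacent if and only if ($a \in S$ or $b \in S$) and $ab \neq ba$. A subset $D$ of the vertex set of a graph $G$ is a dominating set for $G$ if every vertex of $G$ not in $D$ is adjacent to at least one member of $D$. A generating set for a subring is a subset generating it as a ring.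
   Formalization: The formal statement assumes m ≥ 1 (some listed generator lies outside C_K(S), i.e. S is non-commutative); for m = 0 the set B would consist of elements of C_K(S), which are not vertices, so the claim fails. The s_i are taken distinct. *)

theory Defs
  imports "HOL-Algebra.AbelCoset" "HOL.Hull" "Graph_Theory.Pair_Digraph"
begin

text \<open>
  Subrings and generation are taken in the sense of rings that need not have a unity: a subring is
  an additive subgroup closed under multiplication, and it need not contain \<open>\<one>\<close>. This is why the
  library's \<open>subring\<close> and \<open>generate_ring\<close>, which both force \<open>\<one>\<close> into the set, are not used.
\<close>

definition is_subring :: "'a set \<Rightarrow> ('a, 'b) ring_scheme \<Rightarrow> bool" where
  "is_subring T R \<longleftrightarrow> additive_subgroup T R \<and> (\<forall>x\<in>T. \<forall>y\<in>T. x \<otimes>\<^bsub>R\<^esub> y \<in> T)"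

definition generating_set :: "('a, 'b) ring_scheme \<Rightarrow> 'a set \<Rightarrow> 'a set \<Rightarrow> bool" where
  "generating_set R A S \<longleftrightarrow> A \<subseteq> S \<and> (\<lambda>T. is_subring T R) hull A = S"

text \<open>\<open>centralizer R K S\<close> is \<open>C\<^sub>K(S)\<close>.\<close>

definition centralizer :: "('a, 'b) ring_scheme \<Rightarrow> 'a set \<Rightarrow> 'a set \<Rightarrow> 'a set" where
  "centralizer R K S = {k \<in> K. \<forall>s\<in>S. k \<otimes>\<^bsub>R\<^esub> s = s \<otimes>\<^bsub>R\<^esub> k}"

definition gen_noncomm_verts :: "('a, 'b) ring_scheme \<Rightarrow> 'a set \<Rightarrow> 'a set \<Rightarrow> 'a set" where
  "gen_noncomm_verts R S K = (S \<union> K) - (centralizer R K S \<union> centralizer R S K)"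

text \<open>
  A simple graph is encoded as a symmetric loop-free digraph without parallel arcs
  (locale \<open>pair_graph\<close>); \<open>a\<close> and \<open>b\<close> are adjacent iff \<open>a \<rightarrow>\<^bsub>G\<^esub> b\<close>.
\<close>

definition gen_noncomm_graph ::
    "('a, 'b) ring_scheme \<Rightarrow> 'a set \<Rightarrow> 'a set \<Rightarrow> 'a pair_pre_digraph" where
  "gen_noncomm_graph R S K =
    \<lparr> pverts = gen_noncomm_verts R S K,
      parcs = {(a, b). a \<in> gen_noncomm_verts R S K \<and> b \<in> gen_noncomm_verts R S K \<and> a \<noteq> b \<and>
                 (a \<in> S \<or> b \<in> S) \<and> a \<otimes>\<^bsub>R\<^esub> b \<noteq> b \<otimes>\<^bsub>R\<^esub> a} \<rparr>"

lemma pair_graph_gen_noncomm_graph: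
  assumes "finite S" and "finite K"
  shows "pair_graph (gen_noncomm_graph R S K)"
proof -
  let ?V = "gen_noncomm_verts R S K"
  have fin: "finite ?V"
    using assms by (simp add: gen_noncomm_verts_def)
  have "parcs (gen_noncomm_graph R S K) \<subseteq> ?V \<times> ?V"
    by (auto simp: gen_noncomm_graph_def)
  then have "finite (parcs (gen_noncomm_graph R S K))"
    using fin by (meson finite_SigmaI finite_subset)
  with fin show ?thesis
    by unfold_locales
      (auto simp: gen_noncomm_graph_def symmetric_def sym_def)
qed

lemma pverts_gen_noncomm_graph_subset:
  assumes "S \<subseteq> K"
  shows "pverts (gen_noncomm_graph R S K) = K - centralizer R K S"
  using assms by (auto simp: gen_noncomm_graph_def gen_noncomm_verts_def centralizer_def)

definition dominating_set :: "('a, 'b) pre_digraph \<Rightarrow> 'a set \<Rightarrow> bool" where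
  "dominating_set G D \<longleftrightarrow> D \<subseteq> verts G \<and> (\<forall>v \<in> verts G - D. \<exists>d\<in>D. v \<rightarrow>\<^bsub>G\<^esub> d)"

end

theory Submission
  imports Defs
begin

text \<open>
  An element commuting with every generator of \<open>S\<close> commutes with all of \<open>S\<close>, because its
  centralizer in \<open>S\<close> is a subring. So a vertex \<open>v\<close> fails to commute with some \<open>s\<^sub>i\<close>. If \<open>i \<le> m\<close>, then
  \<open>v\<close> is adjacent to \<open>s\<^sub>i\<close>. If \<open>i > m\<close>, then \<open>v\<close> is adjacent to \<open>s\<^sub>1\<close>, or it commutes with \<open>s\<^sub>1\<close> and
  hence does not commute with \<open>s\<^sub>1 + s\<^sub>i\<close>.
\<close>

lemma is_subring_subset_carrier:
  assumes "is_subring T R"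
  shows "T \<subseteq> carrier R"
  using assms additive_subgroup.a_subset unfolding is_subring_def by blast

text \<open>\<open>S\<close> is only assumed to be a subset of the carrier, so the lemma covers both
  \<open>centralizer R K S\<close> and the centralizer in \<open>S\<close> of a single element
  \<open>v\<close>.\<close>

lemma is_subring_centralizer:
  assumes R: "ring R" and K: "is_subring K R" and S: "S \<subseteq> carrier R"
  shows "is_subring (centralizer R K S) R"
proof -
  interpret ring R by (fact R)
  interpret K: additive_subgroup K R
    using K by (simp add: is_subring_def)
  have mult: "x \<otimes>\<^bsub>R\<^esub> y \<in> K" if "x \<in> K" "y \<in> K" for x y
    using K that by (simp add: is_subring_def)
  have carr: "x \<in> carrier R" if "x \<in> K \<or> x \<in> S" for x
    using that K.a_subset S by blast
  have "subgroup (centralizer R K S) (add_monoid R)"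
  proof (rule add.subgroupI)
    show "centralizer R K S \<subseteq> carrier R"
      using K.a_subset by (auto simp: centralizer_def)
    show "centralizer R K S \<noteq> {}"
      using K.zero_closed carr by (auto simp: centralizer_def intro!: exI[of _ "\<zero>\<^bsub>R\<^esub>"])
    fix a b assume a: "a \<in> centralizer R K S" and b: "b \<in> centralizer R K S"
    show "\<ominus>\<^bsub>R\<^esub> a \<in> centralizer R K S"
      using a K.a_inv_closed[of a] carr by (auto simp: centralizer_def l_minus r_minus)
    show "a \<oplus>\<^bsub>R\<^esub> b \<in> centralizer R K S"
      using a b carr by (auto simp: centralizer_def l_distr r_distr)
  qed
  moreover have "x \<otimes>\<^bsub>R\<^esub> y \<in> centralizer R K S"
    if "x \<in> centralizer R K S" "y \<in> centralizer R K S" for x y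
  proof -
    have "(x \<otimes>\<^bsub>R\<^esub> y) \<otimes>\<^bsub>R\<^esub> s = s \<otimes>\<^bsub>R\<^esub> (x \<otimes>\<^bsub>R\<^esub> y)" if "s \<in> S" for s
      using \<open>x \<in> _\<close> \<open>y \<in> _\<close> that carr m_assoc
      by (simp add: centralizer_def) (metis carr m_assoc)
    then show ?thesis
      using that mult by (simp add: centralizer_def)
  qed
  ultimately show ?thesis
    by (simp add: is_subring_def additive_subgroup_def)
qed

text \<open>Subtract \<open>h\<close>. It is used in contrapositive form: adding an element of a
  subring to an element outside it gives a sum outside it.\<close>

lemma is_subring_add_cancel_right:
  assumes R: "ring R" and T: "is_subring T R"
    and x: "x \<in> carrier R" and h: "h \<in> T" and xh: "x \<oplus>\<^bsub>R\<^esub> h \<in> T"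
  shows "x \<in> T"
proof -
  interpret ring R by (fact R)
  interpret T: additive_subgroup T R
    using T by (simp add: is_subring_def)
  have "x = (x \<oplus>\<^bsub>R\<^esub> h) \<oplus>\<^bsub>R\<^esub> (\<ominus>\<^bsub>R\<^esub> h)"
    using x h by (simp add: a_assoc r_neg)
  then show ?thesis
    using h xh T.a_closed T.a_inv_closed by metis
qed

lemma generating_set_not_commuting:
  assumes R: "ring R" and S: "is_subring S R" and A: "generating_set R A S"
    and v: "v \<in> carrier R" and x: "x \<in> S" "v \<otimes>\<^bsub>R\<^esub> x \<noteq> x \<otimes>\<^bsub>R\<^esub> v"
  obtains a where "a \<in> A" "a \<notin> centralizer R S {v}"
proof -
  have "\<not> A \<subseteq> centralizer R S {v}"
  proof
    assume "A \<subseteq> centralizer R S {v}"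
    then have "(\<lambda>T. is_subring T R) hull A \<subseteq> centralizer R S {v}"
      using is_subring_centralizer[OF R S] v by (intro hull_minimal) auto
    then show False
      using A x by (auto simp: generating_set_def centralizer_def)
  qed
  then show ?thesis
    using that by blast
qed

theorem proposition3p5:
  fixes R :: "('a, 'b) ring_scheme" (structure)
    and S K A :: "'a set"
    and s :: "nat \<Rightarrow> 'a"
    and m n :: nat
  assumes "ring R"
    and "finite (carrier R)"
    and "\<exists>x\<in>carrier R. \<exists>y\<in>carrier R. x \<otimes> y \<noteq> y \<otimes> x"
    and "is_subring S R"
    and "is_subring K R"
    and "S \<subseteq> K"
    and "1 \<le> m" and "m \<le> n"
    and "inj_on s {1..n}"
    and "A = s ` {1..n}"
    and "generating_set R A S"
    and "A \<inter> centralizer R K S = s ` {m+1..n}"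
  shows "dominating_set (gen_noncomm_graph R S K)
           (s ` {1..m} \<union> (\<lambda>j. s 1 \<oplus> s j) ` {m+1..n})"
proof -
  note R = \<open>ring R\<close> and S = \<open>is_subring S R\<close> and K = \<open>is_subring K R\<close>
  interpret ring R by (fact R)
  let ?G = "gen_noncomm_graph R S K" and ?C = "centralizer R K S"
  let ?B = "s ` {1..m} \<union> (\<lambda>j. s 1 \<oplus> s j) ` {m+1..n}"
  have Scarr: "S \<subseteq> carrier R" and Kcarr: "K \<subseteq> carrier R"
    using is_subring_subset_carrier S K by blast+
  have sS: "s i \<in> S" if "i \<in> {1..n}" for i
    using that assms(10,11) by (auto simp: generating_set_def)
  \<comment> \<open>\<open>A \<inter> ?C\<close> is exactly the image of the indices above
    \<open>m\<close>; injectivity of \<open>s\<close> keeps \<open>s i\<close> with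
    \<open>i \<le> m\<close> out of that image.\<close>
  have noncentral: "s i \<notin> ?C" if "i \<in> {1..m}" for i
  proof
    assume "s i \<in> ?C"
    then have "s i \<in> s ` {m+1..n}"
      using that assms(8,10,12) by auto
    then show False
      using that assms(8) inj_onD[OF assms(9)] by fastforce
  qed
  have central: "s j \<in> ?C" if "j \<in> {m+1..n}" for j
    using that assms(12) by blast
  have BS: "?B \<subseteq> S"
    using sS assms(7,8) S additive_subgroup.a_closed[of S R]
    by (auto simp: is_subring_def)
  \<comment> \<open>The summand \<open>s j\<close> lies in the subring \<open>?C\<close> and is
    cancelled, while \<open>s 1\<close> lies outside because \<open>1 \<le> m\<close>. So the sums
    are vertices.\<close>
  have "s 1 \<oplus> s j \<notin> ?C" if "j \<in> {m+1..n}" for j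
    using is_subring_add_cancel_right[OF R is_subring_centralizer[OF R K Scarr]]
      central[OF that] noncentral[of 1] sS[of 1] Scarr assms(7,8) by auto
  then have BV: "?B \<subseteq> K - ?C"
    using BS noncentral assms(6) by blast
  have verts: "verts (with_proj ?G) = K - ?C"
    using pverts_gen_noncomm_graph_subset[OF assms(6)] by simp
  have "\<exists>d\<in>?B. v \<rightarrow>\<^bsub>?G\<^esub> d" if v: "v \<in> K - ?C" "v \<notin> ?B" for v
  proof -
    let ?Z = "centralizer R S {v}"
    have vcarr: "v \<in> carrier R"
      using v Kcarr by blast
    obtain x where "x \<in> S" "v \<otimes> x \<noteq> x \<otimes> v"
      using v by (auto simp: centralizer_def)
    then obtain a where "a \<in> A" "a \<notin> ?Z"
      using generating_set_not_commuting[OF R S assms(11) vcarr] by blast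
    then obtain i where i: "i \<in> {1..n}" "s i \<notin> ?Z"
      using assms(10) by blast
    \<comment> \<open>Since \<open>?B \<subseteq> S\<close>, a member of \<open>?B\<close> outside
      \<open>?Z\<close> is one that does not commute with \<open>v\<close>.\<close>
    have "\<exists>d\<in>?B. d \<notin> ?Z"
    proof (cases "i \<le> m")
      case True
      then show ?thesis
        using i by auto
    next
      case False
      have Z: "is_subring ?Z R"
        using is_subring_centralizer[OF R S] vcarr by simp
      have carr: "s 1 \<in> carrier R" "s i \<in> carrier R"
        using sS i assms(7,8) Scarr by auto
      \<comment> \<open>The roles are reversed compared with \<open>?C\<close>: here
        \<open>s 1\<close> is the summand that is cancelled and \<open>s i\<close> the one outside
        the subring, hence \<open>a_comm\<close>.\<close>
      have "s 1 \<notin> ?Z \<or> s 1 \<oplus> s i \<notin> ?Z"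
        using is_subring_add_cancel_right[OF R Z, of "s i" "s 1"] carr i a_comm by metis
      then show ?thesis
        using False i assms(7) by auto
    qed
    then obtain d where d: "d \<in> ?B" "d \<notin> ?Z" by blast
    \<comment> \<open>The vertex \<open>v\<close> may lie outside \<open>S\<close>, so the condition
      that one endpoint is in \<open>S\<close> has to come from \<open>d\<close>.\<close>
    then have "d \<in> S" "d \<in> K - ?C" "v \<noteq> d"
      using BS BV v(2) by blast+
    moreover have "v \<otimes> d \<noteq> d \<otimes> v"
      using d \<open>d \<in> S\<close> by (auto simp: centralizer_def)
    ultimately have "v \<rightarrow>\<^bsub>?G\<^esub> d"
      using v(1) pverts_gen_noncomm_graph_subset[OF assms(6), of R]
      by (simp add: gen_noncomm_graph_def)
    then show ?thesis
      using d(1) by blast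
  qed
  then show ?thesis
    unfolding dominating_set_def verts using BV by blast
qed

end
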